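(* Let $d\ge 2$ and $n\ge 0$ be integers and let ${\bf C}=(C_0,\ldots,C_{d-1})$ be any compatible tuple of total orders on $\mathbb{F}^d$. Then the set $S^{d-1}_{n,{\bf C}}$ of $d$-permutations of size $n$ that are admissible with respect to ${\bf C}$ is in bijection with $\mathbb{T}^{2^{d-1}}_n$.
   Context: A $d$-permutation of size $n$ is a tuple $\boldsymbol{\pi}=(\pi_1,\ldots,\pi_{d-1})$ of permutations of $[n]=\{1,\ldots,n\}$; put $\pi_0=\mathrm{id}$. Its points are the $n$ points $(i,\pi_1(i),\ldots,\pi_{d-1}(i))\in[n]^d$, $i\in[n]$; for a point $p$ write $\pi_l(p)$ for its $l$-th coordinate, $l=0,\ldots,d-1$. $S^{d-1}_n$ denotes the set of $d$-permutations of size $n$. For distinct points $p,q$, the direction ${\bf dir}(p,q)\in\{+1,-1\}^d$ is $(\mathrm{sign}(\pi_0(q)-\pi_0(p)),\ldots,\mathrm{sign}(\pi_{d-1}(q)-\pi_{d-1}(p)))$. $\mathbb{F}^d$ is the set of the $2^{d-1}$ directions whose last entry is $-1$. $\mathbb{T}^{2^{d-1}}_n$ is the set of rooted trees with $n$ internal nodes in which every node is either a leaf or an internal node with exactly $2^{d-1}$ children, one labelled by each direction of $\mathbb{F}^d$. For an internal node $r$ and ${\bf f}\in\mathbb{F}^d$, $\mathcal{T}_{\bf f}(r)$ is the subtree rooted at the child of $r$ labelled ${\bf f}$. The max-tree $\gamma^d(\boldsymbol{\pi})\in\mathbb{T}^{2^{d-1}}_n$ is defined recursively: if $\boldsymbol\pi$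 is empty it is a single leaf; otherwise its root is an internal node corresponding to the point $p_{\max}$ with $\pi_{d-1}(p_{\max})=n$, and for each ${\bf f}\in\mathbb{F}^d$ the child labelled ${\bf f}$ is the max-tree of the sub-$d$-permutation formed by the points $p'$ with ${\bf dir}(p_{\max},p')={\bf f}$ (coordinates relabelled order-preservingly). Thus internal nodes correspond bijectively to points of $\boldsymbol\pi$. A total order $C$ on a set of directions is compatible with respect to axis $k$ if no direction with $k$-th entry $+1$ precedes a direction with $k$-th entry $-1$. A tuple ${\bf C}=(C_0,\ldots,C_{d-1})$ of total orders is compatible if each $C_k$ is compatible with respect to axis $k$. $\boldsymbol\pi$ is admissible with respect to ${\bf C}$ if for every internal node $r$ of $\gamma^d(\boldsymbol\pi)$, every $l\in\{0,\ldots,d-1\}$ and all ${\bf f}_1,{\bf f}_2\in\mathbb{F}^d$ with ${\bf f}_1$ preceding ${\bf f}_2$ in $C_l$, every point corresponding to a node of $\mathcal{T}_{{\bf f}_1}(r)$ has smaller $l$-th coordinate than every point corresponding to a node of $\mathcal{T}_{{\bf f}_2}(r)$. *)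

theory Defs
  imports Complex_Main "HOL-Combinatorics.Permutations"
begin

section \<open>Multidimensional permutations and directions\<close>

text \<open>
  A \<open>d\<close>-permutation is the list of its \<open>d - 1\<close> permutations of \<open>{1..n}\<close>, which are the
  identity outside \<open>{1..n}\<close> (library predicate \<open>permutes\<close>), so that distinct lists are distinct
  \<open>d\<close>-permutations.  Points and directions are lists of length \<open>d\<close>, indexed from \<open>0\<close>.
\<close>

definition dperms :: "nat \<Rightarrow> nat \<Rightarrow> (nat \<Rightarrow> nat) list set" where
  "dperms d n = {\<pi>s. length \<pi>s = d - 1 \<and> (\<forall>\<pi>\<in>set \<pi>s. \<pi> permutes {1..n})}"

definition point :: "(nat \<Rightarrow> nat) list \<Rightarrow> nat \<Rightarrow> nat list" where
  "point \<pi>s i = i # map (\<lambda>\<pi>. \<pi> i) \<pi>s"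

definition points :: "nat \<Rightarrow> (nat \<Rightarrow> nat) list \<Rightarrow> nat list set" where
  "points n \<pi>s = point \<pi>s ` {1..n}"

definition dir :: "nat list \<Rightarrow> nat list \<Rightarrow> int list" where
  "dir p q = map2 (\<lambda>x y. sgn (int y - int x)) p q"

definition fdirs :: "nat \<Rightarrow> int list set" where
  "fdirs d = {f. length f = d \<and> set f \<subseteq> {1, -1} \<and> f ! (d - 1) = -1}"

section \<open>Trees\<close>

text \<open>Internal nodes carry a label; their children form a partial map from directions.\<close>

datatype 'a dtree = Leaf | Node 'a "int list \<Rightarrow> 'a dtree option"

inductive full_dtree :: "nat \<Rightarrow> 'a dtree \<Rightarrow> bool" for d where
  full_Leaf: "full_dtree d Leaf"
| full_Node: "dom c = fdirs d \<Longrightarrow> (\<And>f t. c f = Some t \<Longrightarrow> full_dtree d t) \<Longrightarrow> full_dtree d (Node x c)"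

primrec internal_nodes :: "'a dtree \<Rightarrow> nat" where
  "internal_nodes Leaf = 0"
| "internal_nodes (Node x c) = Suc (\<Sum>f\<in>dom c. the (map_option internal_nodes (c f)))"

definition dtrees :: "nat \<Rightarrow> nat \<Rightarrow> unit dtree set" where
  "dtrees d n = {t. full_dtree d t \<and> internal_nodes t = n}"

inductive_set subtrees :: "'a dtree \<Rightarrow> 'a dtree set" for t where
  subtree_self: "t \<in> subtrees t"
| subtree_child: "Node x c \<in> subtrees t \<Longrightarrow> c f = Some s \<Longrightarrow> s \<in> subtrees t"

section \<open>Max-trees\<close>

lemma arg_max_on_in:
  fixes g :: "'a \<Rightarrow> nat"
  assumes "finite P" "P \<noteq> {}"
  shows "arg_max_on g P \<in> P" and "q \<in> P \<Longrightarrow> g q \<le> g (arg_max_on g P)"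
proof -
  have fin: "finite (g ` P)" and ne: "g ` P \<noteq> {}" using assms by auto
  obtain k where k: "k \<in> P" "g k = Max (g ` P)" using Max_in[OF fin ne] by force
  have "\<forall>y. y \<in> P \<longrightarrow> g y < Suc (Max (g ` P))"
    using fin by (auto simp: less_Suc_eq_le)
  from arg_max_nat_lemma[of "\<lambda>x. x \<in> P", OF k(1) this]
  show "arg_max_on g P \<in> P" and "q \<in> P \<Longrightarrow> g q \<le> g (arg_max_on g P)"
    by (auto simp: arg_max_on_def)
qed

text \<open>
  The max-tree is defined on finite sets of points, and each internal node is labelled by the point
  it corresponds to.  The points of a sub-\<open>d\<close>-permutation are kept with their original coordinates:
  the recursion only uses comparisons of coordinates, so an order-preserving relabelling would
  change nothing but the labels (lemma \<open>max_tree_relabel\<close> below).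
\<close>

function max_tree :: "nat \<Rightarrow> nat list set \<Rightarrow> nat list dtree" where
  "max_tree d P =
     (if finite P \<and> P \<noteq> {} then
        Node (arg_max_on (\<lambda>p. p ! (d - 1)) P)
          (\<lambda>f. if f \<in> fdirs d
               then Some (max_tree d {q \<in> P - {arg_max_on (\<lambda>p. p ! (d - 1)) P}.
                                        dir (arg_max_on (\<lambda>p. p ! (d - 1)) P) q = f})
               else None)
      else Leaf)"
  by pat_completeness auto
termination
proof (relation "measure (\<lambda>(d, P). card P)", goal_cases)
  case 1
  then show ?case by simp
next
  case (2 d P f)
  then have "arg_max_on (\<lambda>p. p ! (d - 1)) P \<in> P" by (intro arg_max_on_in) auto
  then have "{q \<in> P - {arg_max_on (\<lambda>p. p ! (d - 1)) P}.
               dir (arg_max_on (\<lambda>p. p ! (d - 1)) P) q = f} \<subset> P" by blast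
  then show ?case using 2 by (simp add: psubset_card_mono)
qed

declare max_tree.simps [simp del]

definition relabel :: "(nat \<Rightarrow> nat \<Rightarrow> nat) \<Rightarrow> nat list \<Rightarrow> nat list" where
  "relabel \<phi> p = map (\<lambda>l. \<phi> l (p ! l)) [0..<length p]"

lemma max_tree_relabel:
  assumes "finite P" "d \<ge> 1"
    and "\<And>p. p \<in> P \<Longrightarrow> length p = d"
    and "inj_on (\<lambda>p. p ! (d - 1)) P"
    and "\<And>l. l < d \<Longrightarrow> strict_mono_on ((\<lambda>p. p ! l) ` P) (\<phi> l)"
  shows "max_tree d (relabel \<phi> ` P) = map_dtree (relabel \<phi>) (max_tree d P)"
  using assms
proof (induction "card P" arbitrary: P rule: less_induct)
  case less
  let ?g = "\<lambda>p::nat list. p ! (d - 1)" and ?R = "relabel \<phi>"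
  show ?case
  proof (cases "P = {}")
    case True
    then show ?thesis by (simp add: max_tree.simps)
  next
    case False
    define m where "m = arg_max_on ?g P"
    have m: "m \<in> P" "\<And>q. q \<in> P \<Longrightarrow> ?g q \<le> ?g m"
      unfolding m_def using arg_max_on_in[OF less.prems(1) False] by auto
    have nth: "?R p ! l = \<phi> l (p ! l)" if "p \<in> P" "l < d" for p l
      using that less.prems(3) by (simp add: relabel_def)
    have len: "length (?R p) = d" if "p \<in> P" for p
      using that less.prems(3) by (simp add: relabel_def)
    have less_iff: "?R p ! l < ?R q ! l \<longleftrightarrow> p ! l < q ! l" if "p \<in> P" "q \<in> P" "l < d" for p q l
      using that strict_mono_on_less[OF less.prems(5)[of l]] by (simp add: nth)
    have inj: "p = q" if "p \<in> P" "q \<in> P" "?g (?R p) = ?g (?R q)" for p q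
    proof -
      have "?g p = ?g q"
        using that less_iff[of p q "d - 1"] less_iff[of q p "d - 1"] less.prems(2) by force
      then show ?thesis using less.prems(4) that by (auto dest: inj_onD)
    qed
    define m' where "m' = arg_max_on ?g (?R ` P)"
    have m': "m' \<in> ?R ` P" "\<And>q. q \<in> ?R ` P \<Longrightarrow> ?g q \<le> ?g m'"
      unfolding m'_def using less.prems(1) False by (auto intro!: arg_max_on_in)
    from m'(1) obtain p where p: "p \<in> P" "m' = ?R p" by auto
    have "?g m \<le> ?g p"
      using m'(2)[of "?R m"] m(1) p less_iff[of p m "d - 1"] less.prems(2) by force
    then have "p = m" using m(2)[OF p(1)] less.prems(4) p(1) m(1) by (auto dest: inj_onD)
    with p have m'm: "m' = ?R m" by simp
    have sgn_eq: "sgn (int (?R q ! l) - int (?R m ! l)) = sgn (int (q ! l) - int (m ! l))"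
      if "q \<in> P" "l < d" for q l
      using less_iff[OF that(1) m(1) that(2)] less_iff[OF m(1) that]
      by (auto simp: sgn_if)
    have dir_eq: "dir (?R m) (?R q) = dir m q" if "q \<in> P" for q
      using that m(1) less.prems(3) len sgn_eq
      by (auto simp: dir_def intro!: nth_equalityI)
    have sub_eq: "{q \<in> ?R ` P - {m'}. dir m' q = f} = ?R ` {q \<in> P - {m}. dir m q = f}" for f
      using inj m(1) by (auto simp: m'm dir_eq)
    have rec: "max_tree d (?R ` {q \<in> P - {m}. dir m q = f})
        = map_dtree ?R (max_tree d {q \<in> P - {m}. dir m q = f})" for f
    proof (rule less.hyps)
      show "card {q \<in> P - {m}. dir m q = f} < card P"
        using m(1) less.prems(1) by (intro psubset_card_mono) auto
      show "inj_on ?g {q \<in> P - {m}. dir m q = f}"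
        using less.prems(4) by (rule inj_on_subset) auto
      show "strict_mono_on ((\<lambda>p. p ! l) ` {q \<in> P - {m}. dir m q = f}) (\<phi> l)" if "l < d" for l
        using less.prems(5)[OF that] by (rule monotone_on_subset) auto
    qed (use less.prems in auto)
    have "max_tree d (?R ` P) = Node m'
        (\<lambda>f. if f \<in> fdirs d then Some (max_tree d {q \<in> ?R ` P - {m'}. dir m' q = f}) else None)"
      unfolding m'_def using less.prems(1) False by (subst max_tree.simps) simp
    moreover have "max_tree d P = Node m
        (\<lambda>f. if f \<in> fdirs d then Some (max_tree d {q \<in> P - {m}. dir m q = f}) else None)"
      unfolding m_def using less.prems(1) False by (subst max_tree.simps) simp
    ultimately show ?thesis
      by (simp only: sub_eq rec) (simp add: m'm fun_eq_iff)
  qed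
qed

definition gamma :: "nat \<Rightarrow> nat \<Rightarrow> (nat \<Rightarrow> nat) list \<Rightarrow> nat list dtree" where
  "gamma d n \<pi>s = max_tree d (points n \<pi>s)"

section \<open>Compatibility and admissibility\<close>

text \<open>Total orders are reflexive relations (library predicate \<open>linear_order_on\<close>).\<close>

definition precedes :: "'a rel \<Rightarrow> 'a \<Rightarrow> 'a \<Rightarrow> bool" where
  "precedes C f g \<longleftrightarrow> (f, g) \<in> C \<and> f \<noteq> g"

definition compatible_axis :: "nat \<Rightarrow> int list rel \<Rightarrow> bool" where
  "compatible_axis k C \<longleftrightarrow> (\<nexists>f g. precedes C f g \<and> f ! k = 1 \<and> g ! k = -1)"

definition compatible :: "int list rel list \<Rightarrow> bool" where
  "compatible Cs \<longleftrightarrow> (\<forall>k<length Cs. compatible_axis k (Cs ! k))"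

definition admissible :: "nat \<Rightarrow> nat \<Rightarrow> int list rel list \<Rightarrow> (nat \<Rightarrow> nat) list \<Rightarrow> bool" where
  "admissible d n Cs \<pi>s \<longleftrightarrow>
     (\<forall>r c. Node r c \<in> subtrees (gamma d n \<pi>s) \<longrightarrow>
       (\<forall>l<d. \<forall>f1\<in>fdirs d. \<forall>f2\<in>fdirs d. precedes (Cs ! l) f1 f2 \<longrightarrow>
         (\<forall>p\<in>set_dtree (the (c f1)). \<forall>q\<in>set_dtree (the (c f2)). p ! l < q ! l)))"

definition admissible_dperms :: "nat \<Rightarrow> nat \<Rightarrow> int list rel list \<Rightarrow> (nat \<Rightarrow> nat) list set" where
  "admissible_dperms d n Cs = {\<pi>s \<in> dperms d n. admissible d n Cs \<pi>s}"

end

theory Submission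
  imports Defs
begin

text \<open>
  A point set realizes a tree if it splits into a maximal point and, for each direction seen from
  that point, a set realizing the corresponding subtree, these sets being separated along every axis
  as the orders prescribe.  The realizing sets are exactly the admissible ones whose max-tree has
  the given shape.  Along each axis the mutual order of the blocks is prescribed, and compatibility
  says precisely that the maximal point fits between the blocks on its two sides; so every tree has
  a realization, obtained by shifting realizations of its subtrees, and any two realizations are
  order isomorphic along all axes.  Replacing coordinates by ranks gives exactly one
  \<open>d\<close>-permutation for each tree.
\<close>

section \<open>Directions\<close>

lemma finite_fdirs: "finite (fdirs d)"
  by (rule finite_subset[OF _ finite_lists_length_eq[of "{1, -1::int}" d]]) (auto simp: fdirs_def)

lemma fdirs_nth: "f \<in> fdirs d \<Longrightarrow> l < d \<Longrightarrow> f ! l = 1 \<or> f ! l = -1"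
  using nth_mem[of l f] unfolding fdirs_def by blast

lemma dir_nth:
  "length p = d \<Longrightarrow> length q = d \<Longrightarrow> l < d \<Longrightarrow> dir p q ! l = sgn (int (q ! l) - int (p ! l))"
  by (simp add: dir_def)

lemma dir_nth_1_iff:
  "length p = d \<Longrightarrow> length q = d \<Longrightarrow> l < d \<Longrightarrow> dir p q ! l = 1 \<longleftrightarrow> p ! l < q ! l"
  by (simp add: dir_nth sgn_if)

lemma dir_nth_m1_iff:
  "length p = d \<Longrightarrow> length q = d \<Longrightarrow> l < d \<Longrightarrow> dir p q ! l = -1 \<longleftrightarrow> q ! l < p ! l"
  by (simp add: dir_nth sgn_if)

lemma dir_eqI:
  assumes "length p = d" "length q = d" "f \<in> fdirs d"
    and "\<And>l. l < d \<Longrightarrow> f ! l = 1 \<Longrightarrow> p ! l < q ! l"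
    and "\<And>l. l < d \<Longrightarrow> f ! l = -1 \<Longrightarrow> q ! l < p ! l"
  shows "dir p q = f"
proof (rule nth_equalityI)
  show "length (dir p q) = length f" using assms(1-3) by (simp add: dir_def fdirs_def)
  show "dir p q ! l = f ! l" if "l < length (dir p q)" for l
  proof -
    have l: "l < d" using that assms(1,2) by (simp add: dir_def)
    show ?thesis
      using fdirs_nth[OF assms(3) l] assms(4,5)[OF l] dir_nth_1_iff[OF assms(1,2) l]
        dir_nth_m1_iff[OF assms(1,2) l] by auto
  qed
qed

text \<open>The position of \<open>f\<close> in the order \<open>Cs ! l\<close>, counted from 0; it
  numbers the intervals into which the blocks are placed when a tree is realized.\<close>

definition dir_rank :: "nat \<Rightarrow> int list rel list \<Rightarrow> nat \<Rightarrow> int list \<Rightarrow> nat" where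
  "dir_rank d Cs l f = card {g \<in> fdirs d. precedes (Cs ! l) g f}"

lemma length_relabel [simp]: "length (relabel \<phi> p) = length p"
  by (simp add: relabel_def)

lemma relabel_nth: "l < length p \<Longrightarrow> relabel \<phi> p ! l = \<phi> l (p ! l)"
  by (simp add: relabel_def)

section \<open>Admissible labelled trees\<close>

text \<open>Admissibility is rephrased for arbitrary labelled trees because the subtrees of a
  max-tree belong to point sets that need not come from a \<open>d\<close>-permutation; this makes
  induction possible.\<close>

definition node_admissible :: "nat \<Rightarrow> int list rel list \<Rightarrow> (int list \<Rightarrow> nat list dtree option) \<Rightarrow> bool"
  where "node_admissible d Cs c \<longleftrightarrow>
    (\<forall>l<d. \<forall>f1\<in>fdirs d. \<forall>f2\<in>fdirs d. precedes (Cs ! l) f1 f2 \<longrightarrow>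
      (\<forall>p\<in>set_dtree (the (c f1)). \<forall>q\<in>set_dtree (the (c f2)). p ! l < q ! l))"

definition tree_admissible :: "nat \<Rightarrow> int list rel list \<Rightarrow> nat list dtree \<Rightarrow> bool" where
  "tree_admissible d Cs T \<longleftrightarrow> (\<forall>r c. Node r c \<in> subtrees T \<longrightarrow> node_admissible d Cs c)"

lemma subtrees_trans: "u \<in> subtrees s \<Longrightarrow> s \<in> subtrees t \<Longrightarrow> u \<in> subtrees t"
  by (induction rule: subtrees.induct) (auto intro: subtrees.intros)

lemma subtrees_Leaf: "s \<in> subtrees Leaf \<longleftrightarrow> s = Leaf"
proof
  show "s = Leaf" if "s \<in> subtrees Leaf"
    using that by (induction rule: subtrees.induct) auto
qed (simp add: subtree_self)

lemma subtrees_Node: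
  "s \<in> subtrees (Node r c) \<longleftrightarrow> s = Node r c \<or> (\<exists>f t. c f = Some t \<and> s \<in> subtrees t)"
proof
  show "s = Node r c \<or> (\<exists>f t. c f = Some t \<and> s \<in> subtrees t)" if "s \<in> subtrees (Node r c)"
    using that
  proof (induction rule: subtrees.induct)
    case (subtree_child x c' f s)
    then show ?case by (metis dtree.inject subtrees.intros)
  qed simp
  show "s \<in> subtrees (Node r c)" if "s = Node r c \<or> (\<exists>f t. c f = Some t \<and> s \<in> subtrees t)"
    using that by (metis subtrees.intros subtrees_trans)
qed

lemma tree_admissible_Leaf: "tree_admissible d Cs Leaf"
  by (simp add: tree_admissible_def subtrees_Leaf)

lemma tree_admissible_Node:
  "tree_admissible d Cs (Node r c) \<longleftrightarrow>
     node_admissible d Cs c \<and> (\<forall>f t. c f = Some t \<longrightarrow> tree_admissible d Cs t)"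
  unfolding tree_admissible_def subtrees_Node by (metis dtree.inject)

section \<open>Realizations of trees by point sets\<close>

text \<open>The children of a full node have domain exactly \<open>fdirs d\<close>, so an ordinary
  function on directions can stand for the partial map.\<close>

definition children :: "nat \<Rightarrow> (int list \<Rightarrow> 'a dtree) \<Rightarrow> int list \<Rightarrow> 'a dtree option" where
  "children d t = (\<lambda>f. if f \<in> fdirs d then Some (t f) else None)"

lemma children_simps [simp]:
  "f \<in> fdirs d \<Longrightarrow> children d t f = Some (t f)"
  "dom (children d t) = fdirs d"
  by (auto simp: children_def split: if_splits)

lemma children_eq_Some: "children d t f = Some s \<longleftrightarrow> f \<in> fdirs d \<and> s = t f"
  by (auto simp: children_def)

lemma map_children: "map_dtree h (Node x (children d t)) = Node (h x) (children d (map_dtree h \<circ> t))"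
  by (auto simp: children_def)

lemma set_children: "set_dtree (Node x (children d t)) = insert x (\<Union>f\<in>fdirs d. set_dtree (t f))"
  by (force simp: children_def split: if_splits)

text \<open>Maximality of \<open>m\<close> is implicit: directions in \<open>fdirs d\<close> end in
  -1. Coordinates need not fill \<open>{1..n}\<close>, so the blocks of a realization are
  realizations as they stand.\<close>

inductive realizes :: "nat \<Rightarrow> int list rel list \<Rightarrow> unit dtree \<Rightarrow> nat list set \<Rightarrow> bool" for d Cs where
  realizes_Leaf: "realizes d Cs Leaf {}"
| realizes_Node: "length m = d \<Longrightarrow>
    (\<And>f. f \<in> fdirs d \<Longrightarrow> realizes d Cs (t f) (Q f)) \<Longrightarrow>
    (\<And>f q. f \<in> fdirs d \<Longrightarrow> q \<in> Q f \<Longrightarrow> dir m q = f) \<Longrightarrow>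
    (\<And>l f1 f2 p q. l < d \<Longrightarrow> f1 \<in> fdirs d \<Longrightarrow> f2 \<in> fdirs d \<Longrightarrow> precedes (Cs ! l) f1 f2 \<Longrightarrow>
       p \<in> Q f1 \<Longrightarrow> q \<in> Q f2 \<Longrightarrow> p ! l < q ! l) \<Longrightarrow>
    realizes d Cs (Node () (children d t)) (insert m (\<Union>f\<in>fdirs d. Q f))"

text \<open>The property of the points of a \<open>d\<close>-permutation that survives passing to
  subsets and to increasing relabellings of the axes.\<close>

definition generic :: "nat \<Rightarrow> nat list set \<Rightarrow> bool" where
  "generic d P \<longleftrightarrow> finite P \<and> (\<forall>p\<in>P. length p = d) \<and> (\<forall>l<d. inj_on (\<lambda>p. p ! l) P)"

lemma generic_subset: "generic d P \<Longrightarrow> Q \<subseteq> P \<Longrightarrow> generic d Q"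
  unfolding generic_def by (meson finite_subset inj_on_subset subsetD)

text \<open>Genericity excludes zero entries, and the comparison on the last axis forces the last
  entry -1. Hence the blocks around a maximal point exhaust the other points.\<close>

lemma generic_dir:
  assumes "generic d P" "p \<in> P" "q \<in> P" "q \<noteq> p" "q ! (d - 1) \<le> p ! (d - 1)" "d \<ge> 1"
  shows "dir p q \<in> fdirs d"
proof -
  have len: "length p = d" "length q = d" using assms(1-3) by (auto simp: generic_def)
  have ne: "p ! l \<noteq> q ! l" if "l < d" for l
    using assms(1-4) that by (auto simp: generic_def dest: inj_onD)
  have "dir p q ! l = 1 \<or> dir p q ! l = -1" if "l < d" for l
    using ne[OF that] dir_nth_1_iff[OF len that] dir_nth_m1_iff[OF len that] by auto
  moreover have "dir p q ! (d - 1) = -1"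
    using ne[of "d - 1"] dir_nth_m1_iff[OF len, of "d - 1"] assms(5,6) by auto
  moreover have "length (dir p q) = d" using len by (simp add: dir_def)
  ultimately show ?thesis
    unfolding fdirs_def by (smt (verit) in_set_conv_nth insertCI mem_Collect_eq subsetI)
qed

lemma max_tree_empty: "max_tree d {} = Leaf"
  by (simp add: max_tree.simps)

text \<open>The maximum is strict, so \<open>arg_max_on\<close> can only choose
  \<open>m\<close>.\<close>

lemma max_tree_Node:
  assumes "finite P" "m \<in> P" "\<And>q. q \<in> P \<Longrightarrow> q \<noteq> m \<Longrightarrow> q ! (d - 1) < m ! (d - 1)"
  shows "max_tree d P = Node m (children d (\<lambda>f. max_tree d {q \<in> P - {m}. dir m q = f}))"
proof -
  let ?a = "arg_max_on (\<lambda>p. p ! (d - 1)) P"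
  have "P \<noteq> {}" using assms(2) by auto
  then have "?a \<in> P" "m ! (d - 1) \<le> ?a ! (d - 1)"
    using arg_max_on_in[OF assms(1), where g = "\<lambda>p. p ! (d - 1)"] assms(2) by auto
  then have a: "?a = m" using assms(3)[of ?a] by auto
  show ?thesis
    using assms(1) \<open>P \<noteq> {}\<close> by (subst max_tree.simps) (simp only: a children_def simp_thms if_True)
qed

section \<open>Normalized point sets\<close>

definition normalized :: "nat \<Rightarrow> nat \<Rightarrow> nat list set \<Rightarrow> bool" where
  "normalized d n P \<longleftrightarrow> generic d P \<and> (\<forall>l<d. (\<lambda>p. p ! l) ` P = {1..n})"

lemma normalized_card: "d \<ge> 1 \<Longrightarrow> normalized d n P \<Longrightarrow> card P = n"
  using card_image[of "\<lambda>p. p ! 0" P] by (auto simp: normalized_def generic_def)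

text \<open>This recovers coordinates from the mutual order of the points along each axis;
  \<open>Suc\<close> appears because coordinates start at 1.\<close>

lemma normalized_rank:
  assumes "normalized d n P" "p \<in> P" "l < d"
  shows "Suc (card {q \<in> P. q ! l < p ! l}) = p ! l"
proof -
  have im: "(\<lambda>p. p ! l) ` P = {1..n}" and inj: "inj_on (\<lambda>p. p ! l) P"
    using assms by (auto simp: normalized_def generic_def)
  have pl: "p ! l \<in> {1..n}" using im assms(2) by blast
  have "(\<lambda>p. p ! l) ` {q \<in> P. q ! l < p ! l} = {x \<in> (\<lambda>p. p ! l) ` P. x < p ! l}" by auto
  also have "\<dots> = {1..<p ! l}" using pl unfolding im by auto
  finally have "card ((\<lambda>p. p ! l) ` {q \<in> P. q ! l < p ! l}) = p ! l - 1" by simp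
  moreover have "card ((\<lambda>p. p ! l) ` {q \<in> P. q ! l < p ! l}) = card {q \<in> P. q ! l < p ! l}"
    using inj by (intro card_image inj_on_subset[OF inj]) auto
  ultimately show ?thesis using pl by simp
qed

section \<open>Normalized sets as the point sets of \<open>d\<close>-permutations\<close>

lemma point_nth: "l < length \<pi>s \<Longrightarrow> point \<pi>s i ! Suc l = (\<pi>s ! l) i"
  by (simp add: point_def)

lemma points_normalized:
  assumes d: "d \<ge> 1" and perms: "\<pi>s \<in> dperms d n"
  shows "normalized d n (points n \<pi>s)"
proof -
  have len: "length \<pi>s = d - 1" and perm: "\<And>\<pi>. \<pi> \<in> set \<pi>s \<Longrightarrow> \<pi> permutes {1..n}"
    using perms by (auto simp: dperms_def)
  \<comment> \<open>Axis 0 carries the identity and axis \<open>Suc k\<close> the permutation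
    \<open>\<pi>s ! k\<close>, so that all axes can be treated alike.\<close>
  have coord: "\<exists>\<pi>. \<pi> permutes {1..n} \<and> (\<forall>i. point \<pi>s i ! l = \<pi> i)" if "l < d" for l
  proof (cases l)
    case 0
    then show ?thesis by (intro exI[of _ id]) (simp add: point_def permutes_id)
  next
    case (Suc k)
    then have "k < length \<pi>s" using that len by simp
    then show ?thesis using Suc perm by (intro exI[of _ "\<pi>s ! k"]) (simp add: point_nth)
  qed
  have "inj_on (\<lambda>p. p ! l) (points n \<pi>s) \<and> (\<lambda>p. p ! l) ` points n \<pi>s = {1..n}" if "l < d" for l
  proof -
    obtain \<pi> where \<pi>: "\<pi> permutes {1..n}" "\<And>i. point \<pi>s i ! l = \<pi> i"
      using coord[OF \<open>l < d\<close>] by auto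
    have "inj_on (\<lambda>p. p ! l) (points n \<pi>s)"
      using permutes_inj[OF \<pi>(1)] by (auto simp: points_def inj_on_def \<pi>(2) dest: injD)
    moreover have "(\<lambda>p. p ! l) ` points n \<pi>s = \<pi> ` {1..n}"
      by (simp add: points_def image_image \<pi>(2))
    ultimately show ?thesis using permutes_image[OF \<pi>(1)] by simp
  qed
  then show ?thesis
    using len d by (auto simp: normalized_def generic_def points_def point_def)
qed

lemma points_inj: "inj_on (points n) (dperms d n)"
proof (rule inj_onI)
  fix \<pi>s \<sigma>s assume \<pi>: "\<pi>s \<in> dperms d n" and \<sigma>: "\<sigma>s \<in> dperms d n" and eq: "points n \<pi>s = points n \<sigma>s"
  show "\<pi>s = \<sigma>s"
  proof (rule nth_equalityI)
    show len: "length \<pi>s = length \<sigma>s" using \<pi> \<sigma> by (simp add: dperms_def)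
    show "\<pi>s ! l = \<sigma>s ! l" if l: "l < length \<pi>s" for l
    proof
      fix i
      show "(\<pi>s ! l) i = (\<sigma>s ! l) i"
      proof (cases "i \<in> {1..n}")
        case True
        then have "point \<pi>s i \<in> points n \<sigma>s" unfolding eq[symmetric] by (simp add: points_def)
        then obtain j where "point \<pi>s i = point \<sigma>s j" by (auto simp: points_def)
        \<comment> \<open>A point carries its own index as entry 0.\<close>
        moreover from this have "i = j" by (simp add: point_def)
        ultimately show ?thesis using point_nth l len by metis
      next
        case False
        have "\<pi>s ! l permutes {1..n}" "\<sigma>s ! l permutes {1..n}"
          using \<pi> \<sigma> l len by (auto simp: dperms_def)
        then show ?thesis using False by (metis permutes_not_in)
      qed
    qed
  qed
qed

text \<open>Axis 0 takes each value in \<open>{1..n}\<close> exactly once, so \<open>P\<close> is a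
  graph over that axis; the other coordinates, as functions of the first, are the
  permutations.\<close>

lemma normalized_points:
  assumes d: "d \<ge> 1" and norm: "normalized d n P"
  shows "\<exists>\<pi>s\<in>dperms d n. points n \<pi>s = P"
proof -
  have gen: "generic d P" and im: "\<And>l. l < d \<Longrightarrow> (\<lambda>p. p ! l) ` P = {1..n}"
    using norm by (auto simp: normalized_def)
  have inj: "inj_on (\<lambda>p. p ! l) P" if "l < d" for l using gen that by (simp add: generic_def)
  have "\<forall>i\<in>{1..n}. \<exists>p\<in>P. p ! 0 = i" using im[of 0] assms(1) by (metis Suc_le_eq One_nat_def imageE)
  then obtain pt where pt: "\<And>i. i \<in> {1..n} \<Longrightarrow> pt i \<in> P" "\<And>i. i \<in> {1..n} \<Longrightarrow> pt i ! 0 = i"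
    by metis
  have pt_nth: "pt (p ! 0) = p" "p ! 0 \<in> {1..n}" if "p \<in> P" for p
  proof -
    show "p ! 0 \<in> {1..n}" using im[of 0] d that by auto
    then show "pt (p ! 0) = p" using pt that inj[of 0] d by (auto dest: inj_onD)
  qed
  have pt_image: "pt ` {1..n} = P" using pt pt_nth by force
  have pt_inj: "inj_on pt {1..n}" using pt(2) by (metis inj_onI)
  \<comment> \<open>The default \<open>i\<close> outside \<open>{1..n}\<close> is what
    \<open>permutes\<close> demands. The list \<open>\<pi>s\<close> starts at axis 1, since
    \<open>point\<close> supplies axis 0 itself.\<close>
  define \<pi> where "\<pi> l i = (if i \<in> {1..n} then pt i ! l else i)" for l i
  define \<pi>s where "\<pi>s = map \<pi> [1..<d]"
  have "\<pi> l permutes {1..n}" if "l < d" for l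
  proof (rule bij_imp_permutes)
    have "bij_betw ((\<lambda>p. p ! l) \<circ> pt) {1..n} {1..n}"
      using inj[OF that] im[OF that] pt_image pt_inj
      by (intro bij_betw_trans[of pt _ P]) (auto simp: bij_betw_def)
    then show "bij_betw (\<pi> l) {1..n} {1..n}"
      by (rule bij_betw_cong[THEN iffD1, rotated]) (simp add: \<pi>_def)
  qed (auto simp: \<pi>_def)
  then have "\<pi>s \<in> dperms d n" by (auto simp: dperms_def \<pi>s_def)
  moreover have "point \<pi>s i = pt i" if "i \<in> {1..n}" for i
  proof (rule nth_equalityI)
    have len: "length (pt i) = d" using gen pt(1)[OF that] by (simp add: generic_def)
    show "length (point \<pi>s i) = length (pt i)" using len d by (simp add: point_def \<pi>s_def)
    show "point \<pi>s i ! l = pt i ! l" if "l < length (point \<pi>s i)" for l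
      using that \<open>i \<in> {1..n}\<close> pt(2)[of i]
      by (cases l) (auto simp: point_def \<pi>s_def \<pi>_def)
  qed
  then have "points n \<pi>s = P" using pt_image by (simp add: points_def)
  ultimately show ?thesis by blast
qed

lemma admissible_iff: "admissible d n Cs \<pi>s \<longleftrightarrow> tree_admissible d Cs (max_tree d (points n \<pi>s))"
  by (simp add: admissible_def tree_admissible_def node_admissible_def gamma_def)
section \<open>Admissible point sets as realizations\<close>

context
  fixes d :: nat and Cs :: "int list rel list"
  assumes d: "d \<ge> 1"
    and lin: "\<And>k. k < d \<Longrightarrow> linear_order_on (fdirs d) (Cs ! k)"
begin

lemma precedes_total:
  assumes "l < d" "f \<in> fdirs d" "g \<in> fdirs d" "f \<noteq> g"
  shows "precedes (Cs ! l) f g \<or> precedes (Cs ! l) g f"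
  using lin[OF assms(1)] assms
  by (auto simp: linear_order_on_def total_on_def precedes_def)

lemma precedes_trans:
  assumes "l < d" "precedes (Cs ! l) f g" "precedes (Cs ! l) g h"
  shows "precedes (Cs ! l) f h"
  using lin[OF assms(1)] assms
  unfolding linear_order_on_def partial_order_on_def preorder_on_def precedes_def
  by (metis antisymD transD)

text \<open>The root differs from every other point on each axis because directions in
  \<open>fdirs d\<close> have no zero entry; points of distinct blocks differ because the orders are
  total; within a block the induction applies.\<close>

lemma realizes_generic: "realizes d Cs t P \<Longrightarrow> generic d P"
proof (induction rule: realizes.induct)
  case realizes_Leaf
  then show ?case by (simp add: generic_def)
next
  case (realizes_Node m t Q)
  let ?P = "insert m (\<Union>f\<in>fdirs d. Q f)"
  have len: "length q = d" if "f \<in> fdirs d" "q \<in> Q f" for f q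
    using realizes_Node.IH that by (auto simp: generic_def)
  have mq: "q ! l \<noteq> m ! l" if "f \<in> fdirs d" "q \<in> Q f" "l < d" for f q l
  proof -
    have "dir m q = f" using realizes_Node.hyps that by auto
    then show ?thesis
      using fdirs_nth[OF that(1,3)] dir_nth_1_iff[OF realizes_Node.hyps(1) len[OF that(1,2)] that(3)]
        dir_nth_m1_iff[OF realizes_Node.hyps(1) len[OF that(1,2)] that(3)] by auto
  qed
  have qq: "p = q" if "f \<in> fdirs d" "p \<in> Q f" "g \<in> fdirs d" "q \<in> Q g" "l < d" "p ! l = q ! l"
    for f g p q l
  proof (cases "f = g")
    case True
    then have "inj_on (\<lambda>p. p ! l) (Q f)" using realizes_Node.IH that by (auto simp: generic_def)
    then show ?thesis using that True by (auto dest: inj_onD)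
  next
    case False
    from precedes_total[OF \<open>l < d\<close> that(1,3) this] show ?thesis
      using realizes_Node.hyps(4)[of l f g p q] realizes_Node.hyps(4)[of l g f q p] that by auto
  qed
  have "inj_on (\<lambda>p. p ! l) ?P" if "l < d" for l
    using mq qq that unfolding inj_on_def by (metis UN_E insert_iff)
  moreover have "finite ?P"
    using realizes_Node.IH finite_fdirs by (auto simp: generic_def)
  ultimately show ?case using len realizes_Node.hyps(1) by (auto simp: generic_def)
qed

text \<open>The recursion of \<open>max_tree\<close> finds the same decomposition: \<open>m\<close>
  is the strict maximum, and each block is recovered as the set of points in its direction. The
  equation for \<open>set_dtree\<close> is carried along because admissibility speaks of node labels
  while \<open>realizes\<close> speaks of blocks.\<close>

lemma realizes_max_tree:
  assumes "realizes d Cs t P"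
  shows "map_dtree (\<lambda>_. ()) (max_tree d P) = t \<and> set_dtree (max_tree d P) = P
    \<and> tree_admissible d Cs (max_tree d P) \<and> full_dtree d t \<and> internal_nodes t = card P"
  using assms
proof (induction rule: realizes.induct)
  case realizes_Leaf
  then show ?case by (simp add: max_tree_empty tree_admissible_Leaf full_Leaf)
next
  case (realizes_Node m t Q)
  let ?P = "insert m (\<Union>f\<in>fdirs d. Q f)"
  have R: "realizes d Cs (Node () (children d t)) ?P"
    using realizes_Node.hyps realizes_Node.IH by (intro realizes.realizes_Node) auto
  have gen: "generic d ?P" using realizes_generic[OF R] .
  \<comment> \<open>The last entry of \<open>f\<close> is -1, so every block lies below the root on
    the last axis.\<close>
  have lt: "q ! (d - 1) < m ! (d - 1)" if "f \<in> fdirs d" "q \<in> Q f" for f q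
    using realizes_Node.hyps(3)[OF that] that gen d dir_nth_m1_iff[of m d q "d - 1"]
    by (auto simp: generic_def fdirs_def)
  have m: "m \<notin> Q f" if "f \<in> fdirs d" for f using lt[OF that] by auto
  have sub: "{q \<in> ?P - {m}. dir m q = f} = Q f" if "f \<in> fdirs d" for f
    using realizes_Node.hyps(3) m that by auto
  have "max_tree d ?P = Node m (children d (\<lambda>f. max_tree d {q \<in> ?P - {m}. dir m q = f}))"
    using gen lt by (intro max_tree_Node) (auto simp: generic_def)
  also have "\<dots> = Node m (children d (\<lambda>f. max_tree d (Q f)))"
    using sub by (auto simp: children_def)
  finally have eq: "max_tree d ?P = Node m (children d (\<lambda>f. max_tree d (Q f)))" .
  have "card ?P = Suc (card (\<Union>f\<in>fdirs d. Q f))"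
    using m gen by (subst card_insert_disjoint) (auto simp: generic_def)
  also have "card (\<Union>f\<in>fdirs d. Q f) = (\<Sum>f\<in>fdirs d. card (Q f))"
  proof (rule card_UN_disjoint)
    show "\<forall>f\<in>fdirs d. finite (Q f)"
      using gen by (auto simp: generic_def finite_UN finite_fdirs)
    show "\<forall>f\<in>fdirs d. \<forall>g\<in>fdirs d. f \<noteq> g \<longrightarrow> Q f \<inter> Q g = {}"
      using realizes_Node.hyps(3) by blast
  qed (rule finite_fdirs)
  finally have card: "card ?P = Suc (\<Sum>f\<in>fdirs d. card (Q f))" .
  have "node_admissible d Cs (children d (\<lambda>f. max_tree d (Q f)))"
    using realizes_Node.IH realizes_Node.hyps(4) by (auto simp: node_admissible_def)
  moreover have "full_dtree d (Node () (children d t))"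
    using realizes_Node.IH by (intro full_Node) (auto simp: children_eq_Some)
  moreover have "internal_nodes (Node () (children d t)) = card ?P"
    using realizes_Node.IH by (simp add: card)
  moreover have "children d (map_dtree (\<lambda>_. ()) \<circ> (\<lambda>f. max_tree d (Q f))) = children d t"
    using realizes_Node.IH by (auto simp: children_def)
  ultimately show ?case
    using realizes_Node.IH
    by (simp add: eq map_children set_children tree_admissible_Node children_eq_Some
        del: dtree.map dtree.set internal_nodes.simps)
qed

text \<open>The converse of the preceding lemma. The induction is on cardinality because the blocks
  are proper subsets that are not given by any inductive derivation.\<close>

lemma realizes_shape:
  assumes "generic d P" "tree_admissible d Cs (max_tree d P)"
  shows "realizes d Cs (map_dtree (\<lambda>_. ()) (max_tree d P)) P"
  using assms
proof (induction "card P" arbitrary: P rule: less_induct)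
  case less
  show ?case
  proof (cases "P = {}")
    case True
    then show ?thesis by (simp add: max_tree_empty realizes_Leaf)
  next
    case False
    let ?g = "\<lambda>p::nat list. p ! (d - 1)"
    have fin: "finite P" using less.prems(1) by (simp add: generic_def)
    define m where "m = arg_max_on ?g P"
    have m: "m \<in> P" "\<And>q. q \<in> P \<Longrightarrow> ?g q \<le> ?g m"
      unfolding m_def using arg_max_on_in[OF fin False] by auto
    define Q where "Q f = {q \<in> P - {m}. dir m q = f}" for f
    have "inj_on ?g P" using less.prems(1) d by (auto simp: generic_def)
    then have eq: "max_tree d P = Node m (children d (\<lambda>f. max_tree d (Q f)))"
      unfolding Q_def using fin m
      by (intro max_tree_Node) (auto simp: le_less dest: inj_onD)
    have adm: "node_admissible d Cs (children d (\<lambda>f. max_tree d (Q f)))"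
      and adm': "\<And>f. f \<in> fdirs d \<Longrightarrow> tree_admissible d Cs (max_tree d (Q f))"
      using less.prems(2) by (auto simp: eq tree_admissible_Node children_eq_Some)
    have R: "realizes d Cs (map_dtree (\<lambda>_. ()) (max_tree d (Q f))) (Q f)" if "f \<in> fdirs d" for f
    proof (rule less.hyps)
      show "card (Q f) < card P"
        using m(1) fin by (intro psubset_card_mono) (auto simp: Q_def)
      show "generic d (Q f)" using less.prems(1) by (rule generic_subset) (auto simp: Q_def)
    qed (rule adm'[OF that])
    \<comment> \<open>This turns admissibility, stated for labels of subtrees, into separation of
      the blocks.\<close>
    then have set: "set_dtree (max_tree d (Q f)) = Q f" if "f \<in> fdirs d" for f
      using realizes_max_tree that by blast
    have "P = insert m (\<Union>f\<in>fdirs d. Q f)"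
      using m generic_dir[OF less.prems(1)] d by (auto simp: Q_def)
    moreover have "realizes d Cs (Node () (children d (map_dtree (\<lambda>_. ()) \<circ> (\<lambda>f. max_tree d (Q f)))))
        (insert m (\<Union>f\<in>fdirs d. Q f))"
    proof (rule realizes_Node)
      show "length m = d" using m less.prems(1) by (auto simp: generic_def)
      show "p ! l < q ! l" if "l < d" "f1 \<in> fdirs d" "f2 \<in> fdirs d" "precedes (Cs ! l) f1 f2"
        "p \<in> Q f1" "q \<in> Q f2" for l f1 f2 p q
        using adm that set by (simp add: node_admissible_def)
    qed (use R in \<open>auto simp: Q_def\<close>)
    ultimately show ?thesis unfolding eq map_children by simp
  qed
qed

text \<open>Only comparisons of coordinates on a common axis enter \<open>realizes\<close>.
  Monotonicity is asked only on coordinates that occur, so that the lemma covers rank functions as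
  well as shifts.\<close>

lemma realizes_relabel:
  assumes "realizes d Cs t P"
    and "\<And>l. l < d \<Longrightarrow> strict_mono_on ((\<lambda>p. p ! l) ` P) (\<phi> l)"
  shows "realizes d Cs t (relabel \<phi> ` P)"
  using assms
proof (induction rule: realizes.induct)
  case realizes_Leaf
  then show ?case by (simp add: realizes.realizes_Leaf)
next
  case (realizes_Node m t Q)
  let ?P = "insert m (\<Union>f\<in>fdirs d. Q f)"
  have len: "length q = d" if "q \<in> ?P" for q
    using that realizes_generic realizes_Node.hyps(1,2) by (auto simp: generic_def)
  have less: "relabel \<phi> p ! l < relabel \<phi> q ! l"
    if "p ! l < q ! l" "p \<in> ?P" "q \<in> ?P" "l < d" for p q l
  proof -
    have "\<phi> l (p ! l) < \<phi> l (q ! l)"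
      using that(2,3) by (intro strict_mono_onD[OF realizes_Node.prems[OF that(4)] _ _ that(1)]) blast+
    then show ?thesis using len that by (simp add: relabel_nth)
  qed
  have "realizes d Cs (Node () (children d t))
      (insert (relabel \<phi> m) (\<Union>f\<in>fdirs d. relabel \<phi> ` Q f))"
  proof (rule realizes.realizes_Node)
    show "length (relabel \<phi> m) = d" using len by simp
    show "realizes d Cs (t f) (relabel \<phi> ` Q f)" if "f \<in> fdirs d" for f
    proof (rule realizes_Node.IH[OF that])
      show "strict_mono_on ((\<lambda>p. p ! l) ` Q f) (\<phi> l)" if "l < d" for l
        using realizes_Node.prems[OF that]
        by (rule monotone_on_subset) (use \<open>f \<in> fdirs d\<close> in auto)
    qed
    show "dir (relabel \<phi> m) q = f" if "f \<in> fdirs d" "q \<in> relabel \<phi> ` Q f" for f q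
    proof -
      obtain p where p: "p \<in> Q f" "q = relabel \<phi> p"
        using \<open>q \<in> relabel \<phi> ` Q f\<close> by auto
      have P: "p \<in> ?P" using p that by auto
      have f: "dir m p = f" using realizes_Node.hyps(3) p that by auto
      show ?thesis
      proof (rule dir_eqI[of _ d])
        show "relabel \<phi> m ! l < q ! l" if "l < d" "f ! l = 1" for l
          using that f P len[OF P] len[of m] less[of m l p] dir_nth_1_iff[of m d p l] p by auto
        show "q ! l < relabel \<phi> m ! l" if "l < d" "f ! l = -1" for l
          using that f P len[OF P] len[of m] less[of p l m] dir_nth_m1_iff[of m d p l] p by auto
      qed (use that len[OF P] len[of m] p in auto)
    qed
    show "p ! l < q ! l" if "l < d" "f1 \<in> fdirs d" "f2 \<in> fdirs d" "precedes (Cs ! l) f1 f2"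
      "p \<in> relabel \<phi> ` Q f1" "q \<in> relabel \<phi> ` Q f2" for l f1 f2 p q
    proof -
      obtain p' q' where "p' \<in> Q f1" "p = relabel \<phi> p'" "q' \<in> Q f2" "q = relabel \<phi> q'"
        using \<open>p \<in> relabel \<phi> ` Q f1\<close> \<open>q \<in> relabel \<phi> ` Q f2\<close> by auto
      then show ?thesis
        using less[of p' l q'] realizes_Node.hyps(4)[OF that(1-4)] that(1-3) by auto
    qed
  qed
  then show ?case by (simp add: image_UN)
qed

section \<open>Existence of realizations\<close>

lemma dir_rank_less:
  assumes "l < d" "f \<in> fdirs d" "precedes (Cs ! l) f g"
  shows "dir_rank d Cs l f < dir_rank d Cs l g"
proof -
  have "{h \<in> fdirs d. precedes (Cs ! l) h f} \<subset> {h \<in> fdirs d. precedes (Cs ! l) h g}"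
    using precedes_trans[OF assms(1) _ assms(3)] assms by (auto simp: precedes_def)
  then show ?thesis unfolding dir_rank_def by (intro psubset_card_mono) (simp add: finite_fdirs)
qed

text \<open>By compatibility only negative directions precede a negative one; \<open>f\<close> is
  negative too but does not precede itself, hence strictness.\<close>

lemma dir_rank_neg:
  assumes "compatible_axis l (Cs ! l)" "l < d" "f \<in> fdirs d" "f ! l = -1"
  shows "dir_rank d Cs l f < card {g \<in> fdirs d. g ! l = -1}"
proof -
  have "{g \<in> fdirs d. precedes (Cs ! l) g f} \<subset> {g \<in> fdirs d. g ! l = -1}"
    using assms fdirs_nth by (fastforce simp: compatible_axis_def precedes_def)
  then show ?thesis unfolding dir_rank_def by (intro psubset_card_mono) (simp add: finite_fdirs)
qed

text \<open>By totality and compatibility every negative direction precedes \<open>f\<close>. With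
  the previous lemma, the negative directions form an initial segment of the order, which leaves a
  gap for the root.\<close>

lemma dir_rank_pos:
  assumes "compatible_axis l (Cs ! l)" "l < d" "f \<in> fdirs d" "f ! l = 1"
  shows "card {g \<in> fdirs d. g ! l = -1} \<le> dir_rank d Cs l f"
proof -
  have "precedes (Cs ! l) g f" if "g \<in> fdirs d" "g ! l = -1" for g
    using precedes_total[OF assms(2) that(1) assms(3)] assms that
    by (force simp: compatible_axis_def)
  then show ?thesis unfolding dir_rank_def by (intro card_mono) (auto simp: finite_fdirs)
qed

lemma realizes_exists:
  fixes t :: "unit dtree"
  assumes "\<And>l. l < d \<Longrightarrow> compatible_axis l (Cs ! l)" "full_dtree d t"
  shows "\<exists>P. realizes d Cs t P"
  using assms(2)
proof (induction rule: full_dtree.induct)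
  case full_Leaf
  then show ?case using realizes_Leaf by blast
next
  case (full_Node c x)
  define t where "t f = the (c f)" for f
  have "c f = children d t f" for f
    unfolding t_def children_def full_Node.hyps(1)[symmetric] by (auto simp: domIff)
  then have c: "c = children d t" by auto
  have "\<forall>f\<in>fdirs d. \<exists>P. realizes d Cs (t f) P"
    using full_Node.IH children_simps(1) unfolding c by blast
  then obtain P where P: "\<And>f. f \<in> fdirs d \<Longrightarrow> realizes d Cs (t f) (P f)" by metis
  have len: "length p = d" if "f \<in> fdirs d" "p \<in> P f" for f p
    using realizes_generic[OF P] that by (auto simp: generic_def)
  have "finite (\<Union>f\<in>fdirs d. \<Union>p\<in>P f. set p)"
    using realizes_generic[OF P] finite_fdirs by (auto simp: generic_def)
  \<comment> \<open>\<open>N\<close> exceeds every coordinate of every block, so each block fits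
    into one interval of length \<open>N\<close>.\<close>
  then obtain N where N: "\<And>f p x. f \<in> fdirs d \<Longrightarrow> p \<in> P f \<Longrightarrow> x \<in> set p \<Longrightarrow> x < N"
    unfolding finite_nat_set_iff_bounded by blast
  \<comment> \<open>Along axis \<open>l\<close>, cut the line into intervals of length \<open>N\<close>; the blocks occupy them in the
    order \<open>Cs ! l\<close>, with one interval left free for the root after the last block on its
    negative side.\<close>
  define k where "k l = card {g \<in> fdirs d. g ! l = -1}" for l
  define m where "m = map (\<lambda>l. N * k l) [0..<d]"
  define \<phi> where "\<phi> f l x = N * (dir_rank d Cs l f + (if f ! l = 1 then 1 else 0)) + x" for f l x
  define Q where "Q f = relabel (\<phi> f) ` P f" for f
  have slot: "N * a + x < N * b" if "a < b" "x < N" for a b x :: nat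
  proof -
    have "N * a + x < N * Suc a" using that by simp
    also have "\<dots> \<le> N * b" using that by (intro mult_le_mono2) simp
    finally show ?thesis .
  qed
  have "realizes d Cs (Node () (children d t)) (insert m (\<Union>f\<in>fdirs d. Q f))"
  proof (rule realizes_Node)
    show "length m = d" by (simp add: m_def)
    show "realizes d Cs (t f) (Q f)" if "f \<in> fdirs d" for f
      unfolding Q_def using P[OF that]
      by (rule realizes_relabel) (auto simp: \<phi>_def monotone_on_def)
    show "dir m q = f" if f: "f \<in> fdirs d" and q: "q \<in> Q f" for f q
    proof -
      obtain p where p: "p \<in> P f" "q = relabel (\<phi> f) p" using q by (auto simp: Q_def)
      have lp: "length p = d" using len f p by auto
      have b: "p ! l < N" if "l < d" for l using N[OF f p(1)] lp that by simp
      show ?thesis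
      proof (rule dir_eqI[of _ d])
        show "m ! l < q ! l" if l: "l < d" "f ! l = 1" for l
        proof -
          \<comment> \<open>The root sits at the left end of interval \<open>k l\<close>; the shift
            by one moves a positive block to an interval strictly beyond it.\<close>
          have "N * k l + 0 < N * Suc (dir_rank d Cs l f)"
            using dir_rank_pos[OF assms(1) l(1) f l(2)] l b[OF l(1)]
            by (intro slot) (auto simp: k_def)
          then show ?thesis using l lp p by (simp add: m_def relabel_nth \<phi>_def)
        qed
        show "q ! l < m ! l" if l: "l < d" "f ! l = -1" for l
        proof -
          have "N * dir_rank d Cs l f + p ! l < N * k l"
            using dir_rank_neg[OF assms(1) l(1) f l(2)] l b[OF l(1)]
            by (intro slot) (auto simp: k_def)
          then show ?thesis using l lp p by (simp add: m_def relabel_nth \<phi>_def)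
        qed
      qed (use lp p f in \<open>auto simp: m_def\<close>)
    qed
    show "p ! l < q ! l" if l: "l < d" and f: "f1 \<in> fdirs d" "f2 \<in> fdirs d"
      and pr: "precedes (Cs ! l) f1 f2" and pq: "p \<in> Q f1" "q \<in> Q f2" for l f1 f2 p q
    proof -
      obtain p' q' where p': "p' \<in> P f1" "p = relabel (\<phi> f1) p'"
        and q': "q' \<in> P f2" "q = relabel (\<phi> f2) q'"
        using pq by (auto simp: Q_def)
      have lp: "length p' = d" "length q' = d" using len f p' q' by auto
      \<comment> \<open>If the extra interval is skipped for \<open>f1\<close>, it is skipped for
        \<open>f2\<close> as well, so the shift cannot reverse the order of the blocks.\<close>
      have ff: "f1 ! l = 1 \<Longrightarrow> f2 ! l = 1"
        using assms(1)[OF l] pr fdirs_nth[OF f(2) l] by (auto simp: compatible_axis_def)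
      have "\<phi> f1 l (p' ! l) < \<phi> f2 l 0"
        unfolding \<phi>_def add_0_right using dir_rank_less[OF l f(1) pr] ff N[OF f(1) p'(1)] lp l
        by (intro slot) auto
      also have "\<dots> \<le> \<phi> f2 l (q' ! l)" by (simp add: \<phi>_def)
      finally show ?thesis using lp l p' q' by (simp add: relabel_nth)
    qed
  qed
  then show ?case unfolding c by (metis old.unit.exhaust)
qed

section \<open>Uniqueness of realizations\<close>

text \<open>The tree and the orders fix all comparisons: root against block by the entry of the
  direction, block against block by \<open>Cs ! l\<close>, and inside a block by induction. The
  isomorphisms of the blocks therefore glue.\<close>

lemma realizes_order_iso:
  assumes "realizes d Cs t P" "realizes d Cs t P'"
  shows "\<exists>h. h ` P = P' \<and> (\<forall>p\<in>P. \<forall>q\<in>P. \<forall>l<d. p ! l < q ! l \<longrightarrow> h p ! l < h q ! l)"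
  using assms
proof (induction arbitrary: P' rule: realizes.induct)
  case realizes_Leaf
  then show ?case by (auto elim: realizes.cases)
next
  case (realizes_Node m t Q)
  from realizes_Node.prems obtain m' t' Q' where
    P': "P' = insert m' (\<Union>f\<in>fdirs d. Q' f)" and tt': "children d t = children d t'"
    and m': "length m' = d"
    and R': "\<And>f. f \<in> fdirs d \<Longrightarrow> realizes d Cs (t' f) (Q' f)"
    and dir': "\<And>f q. f \<in> fdirs d \<Longrightarrow> q \<in> Q' f \<Longrightarrow> dir m' q = f"
    and prec': "\<And>l f1 f2 p q. l < d \<Longrightarrow> f1 \<in> fdirs d \<Longrightarrow> f2 \<in> fdirs d \<Longrightarrow>
       precedes (Cs ! l) f1 f2 \<Longrightarrow> p \<in> Q' f1 \<Longrightarrow> q \<in> Q' f2 \<Longrightarrow> p ! l < q ! l"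
    by (cases rule: realizes.cases) blast+
  have "t f = t' f" if "f \<in> fdirs d" for f
    using fun_cong[OF tt', of f] that by simp
  then have "\<forall>f\<in>fdirs d. \<exists>h. h ` Q f = Q' f \<and>
      (\<forall>p\<in>Q f. \<forall>q\<in>Q f. \<forall>l<d. p ! l < q ! l \<longrightarrow> h p ! l < h q ! l)"
    using realizes_Node.IH R' by metis
  then obtain H where H: "\<And>f. f \<in> fdirs d \<Longrightarrow> H f ` Q f = Q' f"
    and mono: "\<And>f p q l. f \<in> fdirs d \<Longrightarrow> p \<in> Q f \<Longrightarrow> q \<in> Q f \<Longrightarrow> l < d \<Longrightarrow> p ! l < q ! l \<Longrightarrow>
      H f p ! l < H f q ! l"
    by metis
  \<comment> \<open>The direction from the root tells which block a point lies in, hence which block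
    map to apply.\<close>
  define h where "h p = (if p = m then m' else H (dir m p) p)" for p
  have len: "length q = d" if "f \<in> fdirs d" "q \<in> Q f" for f q
    using realizes_generic[OF realizes_Node.hyps(2)] that by (auto simp: generic_def)
  have len': "length q = d" if "f \<in> fdirs d" "q \<in> Q' f" for f q
    using realizes_generic[OF R'] that by (auto simp: generic_def)
  have dir: "dir m q = f" if "f \<in> fdirs d" "q \<in> Q f" for f q
    using realizes_Node.hyps(3) that .
  \<comment> \<open>The direction from \<open>m\<close> to itself is 0 on axis 0, whereas
    \<open>f\<close> has no zero entry.\<close>
  have nm: "m \<notin> Q f" if "f \<in> fdirs d" for f
    using dir[OF that] fdirs_nth[OF that, of 0] dir_nth[OF realizes_Node.hyps(1) realizes_Node.hyps(1), of 0] d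
    by auto
  have hm: "h m = m'" by (simp add: h_def)
  have hQ: "h q = H f q" if "f \<in> fdirs d" "q \<in> Q f" for f q
    using dir nm that by (auto simp: h_def)
  have hQ': "h q \<in> Q' f" if "f \<in> fdirs d" "q \<in> Q f" for f q
    using hQ H that by blast
  have "h ` Q f = Q' f" if "f \<in> fdirs d" for f
    using hQ H that by (metis image_cong)
  then have "h ` insert m (\<Union>f\<in>fdirs d. Q f) = P'"
    by (simp add: P' hm image_UN)
  moreover have "h p ! l < h q ! l"
    if p: "p \<in> insert m (\<Union>f\<in>fdirs d. Q f)" and q: "q \<in> insert m (\<Union>f\<in>fdirs d. Q f)"
      and l: "l < d" and less: "p ! l < q ! l" for p q l
  proof -
    consider (mm) "p = m" "q = m"
      | (mQ) f where "p = m" "f \<in> fdirs d" "q \<in> Q f"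
      | (Qm) f where "q = m" "f \<in> fdirs d" "p \<in> Q f"
      | (QQ) f g where "f \<in> fdirs d" "p \<in> Q f" "g \<in> fdirs d" "q \<in> Q g"
      using p q by blast
    then show ?thesis
    proof cases
      case mm
      then show ?thesis using less by simp
    next
      case mQ
      then have "f ! l = 1"
        using dir_nth_1_iff[OF realizes_Node.hyps(1) len l] dir less by auto
      then show ?thesis
        using dir_nth_1_iff[OF m' len' l] dir' hQ' mQ hm by metis
    next
      case Qm
      then have "f ! l = -1"
        using dir_nth_m1_iff[OF realizes_Node.hyps(1) len l] dir less by auto
      then show ?thesis
        using dir_nth_m1_iff[OF m' len' l] dir' hQ' Qm hm by metis
    next
      case QQ
      show ?thesis
      proof (cases "f = g")
        case True
        then show ?thesis using QQ mono hQ l less by auto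
      next
        case False
        \<comment> \<open>The opposite precedence would contradict \<open>p ! l < q ! l\<close>, so
          totality leaves only \<open>f\<close> before \<open>g\<close>.\<close>
        moreover have "\<not> precedes (Cs ! l) g f"
          using realizes_Node.hyps(4)[OF l QQ(3,1) _ QQ(4,2)] less by auto
        ultimately have "precedes (Cs ! l) f g" using precedes_total l QQ by blast
        then show ?thesis using prec' hQ' QQ l by blast
      qed
    qed
  qed
  ultimately show ?case by blast
qed

text \<open>An order isomorphism preserves the number of points below a given point on each axis; in
  normalized sets these numbers are the coordinates up to one, so it fixes every point.\<close>

lemma realizes_normalized_unique:
  assumes "realizes d Cs t P" "realizes d Cs t P'" "normalized d n P" "normalized d n P'"
  shows "P = P'"
proof -
  obtain h where im: "h ` P = P'"
    and mono: "\<And>p q l. p \<in> P \<Longrightarrow> q \<in> P \<Longrightarrow> l < d \<Longrightarrow> p ! l < q ! l \<Longrightarrow> h p ! l < h q ! l"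
    using realizes_order_iso[OF assms(1,2)] by auto
  have gen: "generic d P" "generic d P'" using assms(3,4) by (auto simp: normalized_def)
  have tot: "p ! l < q ! l \<or> q ! l < p ! l" if "p \<in> P" "q \<in> P" "l < d" "p \<noteq> q" for p q l
    using gen(1) that unfolding generic_def by (meson inj_onD nat_neq_iff)
  have inj: "inj_on h P"
    using tot[of _ _ 0] mono[of _ _ 0] d by (intro inj_onI) (metis less_irrefl less_le_trans zero_less_one)
  \<comment> \<open>Each axis orders \<open>P\<close> strictly and totally, so a strictly increasing
    map also reflects the order.\<close>
  have iff: "h p ! l < h q ! l \<longleftrightarrow> p ! l < q ! l" if "p \<in> P" "q \<in> P" "l < d" for p q l
    using tot[OF that] mono[OF that] mono[OF that(2,1,3)] by (metis less_asym)
  have "h p = p" if p: "p \<in> P" for p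
  proof (rule nth_equalityI)
    have hp: "h p \<in> P'" using im p by auto
    then show len: "length (h p) = length p" using gen p by (auto simp: generic_def)
    show "h p ! l = p ! l" if "l < length (h p)" for l
    proof -
      have l: "l < d" using that hp gen by (auto simp: generic_def)
      have "{q \<in> P'. q ! l < h p ! l} = h ` {q \<in> P. q ! l < p ! l}"
        using iff[OF _ p l] im by auto
      moreover have "card (h ` {q \<in> P. q ! l < p ! l}) = card {q \<in> P. q ! l < p ! l}"
        by (intro card_image inj_on_subset[OF inj]) auto
      ultimately show ?thesis
        using normalized_rank[OF assms(3) p l] normalized_rank[OF assms(4) hp l] by simp
    qed
  qed
  then show ?thesis using im by auto
qed

section \<open>Normalizing a realization by ranks\<close>

lemma realizes_normalize:
  assumes "realizes d Cs t P" "card P = n"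
  shows "\<exists>P'. realizes d Cs t P' \<and> normalized d n P'"
proof -
  \<comment> \<open>The rank of \<open>x\<close> among the coordinates on axis \<open>l\<close>,
    counted from 1.\<close>
  define \<phi> where "\<phi> l x = Suc (card {p \<in> P. p ! l < x})" for l x
  have gen: "generic d P" using realizes_generic[OF assms(1)] .
  then have fin: "finite P" by (simp add: generic_def)
  have "\<phi> l (p ! l) < \<phi> l (q ! l)" if "p \<in> P" "q \<in> P" "p ! l < q ! l" for p q l
  proof -
    have "{r \<in> P. r ! l < p ! l} \<subset> {r \<in> P. r ! l < q ! l}" using that by auto
    then show ?thesis unfolding \<phi>_def using fin by (auto intro: psubset_card_mono)
  qed
  then have "strict_mono_on ((\<lambda>p. p ! l) ` P) (\<phi> l)" for l by (auto simp: monotone_on_def)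
  then have R: "realizes d Cs t (relabel \<phi> ` P)" using realizes_relabel assms(1) by blast
  then have gen': "generic d (relabel \<phi> ` P)" by (rule realizes_generic)
  \<comment> \<open>Both sets have as many points as \<open>t\<close> has internal nodes.\<close>
  have card: "card (relabel \<phi> ` P) = n"
    using realizes_max_tree[OF R] realizes_max_tree[OF assms(1)] assms(2) by simp
  have "(\<lambda>p. p ! l) ` relabel \<phi> ` P = {1..n}" if l: "l < d" for l
  \<comment> \<open>There are \<open>n\<close> distinct ranks, all in \<open>{1..n}\<close>, so they
    fill it.\<close>
  proof (rule card_subset_eq)
    show "card ((\<lambda>p. p ! l) ` relabel \<phi> ` P) = card {1..n}"
      using gen' l card by (subst card_image) (auto simp: generic_def)
    have "\<phi> l (p ! l) \<in> {1..n}" if "p \<in> P" for p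
    proof -
      have "card {q \<in> P. q ! l < p ! l} < card P"
        using that fin by (intro psubset_card_mono) auto
      then show ?thesis using assms(2) by (simp add: \<phi>_def)
    qed
    then show "(\<lambda>p. p ! l) ` relabel \<phi> ` P \<subseteq> {1..n}"
      using gen l by (auto simp: generic_def relabel_nth)
  qed simp
  then have "normalized d n (relabel \<phi> ` P)" using gen' by (simp add: normalized_def)
  then show ?thesis using R by blast
qed

end

section \<open>The bijection given by the shape of the max-tree\<close>

theorem theorem1:
  fixes d n :: nat and Cs :: "int list rel list"
  assumes "d \<ge> 2"
    and "length Cs = d"
    and "\<forall>k<d. linear_order_on (fdirs d) (Cs ! k)"
    and "compatible Cs"
  shows "\<exists>g. bij_betw g (admissible_dperms d n Cs) (dtrees d n)"
proof -
  have d: "d \<ge> 1" using assms(1) by simp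
  have lin: "\<And>k. k < d \<Longrightarrow> linear_order_on (fdirs d) (Cs ! k)" using assms(3) by simp
  have comp: "\<And>l. l < d \<Longrightarrow> compatible_axis l (Cs ! l)"
    using assms(2,4) by (simp add: compatible_def)
  \<comment> \<open>Erasing the points at the nodes leaves the bare tree.\<close>
  let ?g = "\<lambda>\<pi>s. map_dtree (\<lambda>_. ()) (gamma d n \<pi>s)"
  have norm: "normalized d n (points n \<pi>s)" if "\<pi>s \<in> admissible_dperms d n Cs" for \<pi>s
    using that points_normalized[OF d] by (simp add: admissible_dperms_def)
  have R: "realizes d Cs (?g \<pi>s) (points n \<pi>s)" if "\<pi>s \<in> admissible_dperms d n Cs" for \<pi>s
    using that norm[OF that] realizes_shape[OF d lin]
    by (simp add: gamma_def normalized_def admissible_dperms_def admissible_iff)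
  have "inj_on ?g (admissible_dperms d n Cs)"
  proof (rule inj_onI)
    fix \<pi>s \<sigma>s assume A: "\<pi>s \<in> admissible_dperms d n Cs" "\<sigma>s \<in> admissible_dperms d n Cs"
      and "?g \<pi>s = ?g \<sigma>s"
    then have "points n \<pi>s = points n \<sigma>s"
      using realizes_normalized_unique[OF d lin R[OF A(1)] _ norm[OF A(1)] norm[OF A(2)]] R[OF A(2)]
      by simp
    then show "\<pi>s = \<sigma>s"
      using A points_inj by (auto simp: admissible_dperms_def dest: inj_onD)
  qed
  moreover have "?g \<pi>s \<in> dtrees d n" if "\<pi>s \<in> admissible_dperms d n Cs" for \<pi>s
    using realizes_max_tree[OF d lin R[OF that]] normalized_card[OF d norm[OF that]]
    by (simp add: dtrees_def)
  moreover have "t \<in> ?g ` admissible_dperms d n Cs" if "t \<in> dtrees d n" for t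
  proof -
    have t: "full_dtree d t" "internal_nodes t = n" using that by (auto simp: dtrees_def)
    \<comment> \<open>Surjectivity: realize \<open>t\<close> by some point set, pass to ranks, and
      read off the \<open>d\<close>-permutation.\<close>
    obtain P where P: "realizes d Cs t P" using realizes_exists[OF d lin comp t(1)] by blast
    have "card P = n" using realizes_max_tree[OF d lin P] t(2) by simp
    then obtain P' where P': "realizes d Cs t P'" "normalized d n P'"
      using realizes_normalize[OF d lin P] by blast
    then obtain \<pi>s where \<pi>s: "\<pi>s \<in> dperms d n" "points n \<pi>s = P'"
      using normalized_points[OF d] by blast
    have "\<pi>s \<in> admissible_dperms d n Cs" "?g \<pi>s = t"
      using realizes_max_tree[OF d lin P'(1)] \<pi>s
      by (simp_all add: admissible_dperms_def admissible_iff gamma_def)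
    then show ?thesis by blast
  qed
  ultimately have "bij_betw ?g (admissible_dperms d n Cs) (dtrees d n)"
    unfolding bij_betw_def by blast
  then show ?thesis by blast
qed

end
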